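(* Let $N \ge 1$ be an integer. Order-$N$ AFDF transforms approximate any linear operator in $\mathbb{C}^{N\times N}$ to arbitrary precision. That is, for every matrix $\mathbf{W} \in \mathbb{C}^{N\times N}$ and every $\varepsilon > 0$ there exist diagonal matrices $\mathbf{A}_1,\dots,\mathbf{A}_N,\mathbf{D}_1,\dots,\mathbf{D}_N \in \mathbb{C}^{N\times N}$ with $\mathbf{A}_1 = \mathbf{I}$ such that $$\left\| \mathbf{W} - \prod_{k=1}^{N} \mathbf{A}_k \mathbf{F} \mathbf{D}_k \mathbf{F}^{-1} \right\| < \varepsilon ,$$ where $\mathbf{F}$ is the $N \times N$ discrete Fourier transform matrix and $\|\cdot\|$ is any fixed norm on $\mathbb{C}^{N\times N}$.
   Context: Vectors $\mathbf{x} \in \mathbb{C}^N$ are row vectors and a matrix $\mathbf{W}\in\mathbb{C}^{N\times N}$ acts by $\mathbf{x}\mapsto \mathbf{x}\mathbf{W}$. $\mathbf{F}$ denotes the $N\times N$ discrete Fourier transform matrix, $\mathbf{F} = \left(e^{-2\pi i jk/N}\right)_{0\le j,k\le N-1}$ (a scalar normalization of $\mathbf{F}$ does not affect the expression $\mathbf{F}\mathbf{D}\mathbf{F}^{-1}$). For an integer $K\ge 1$, an order-$K$ (complex) AFDF transformation is a map of the form $$\operatorname{AFDF}_K(\mathbf{x}) = \mathbf{x}\left[\prod_{k=1}^{K} \mathbf{A}_k \mathbf{F}\mathbf{D}_k\mathbf{F}^{-1}\right],$$ where $\mathbf{A}_k, \mathbf{D}_k\in\mathbb{C}^{N\times N}$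 are complex diagonal matrices (possibly different for different $k$; diagonal entries are arbitrary complex numbers), with $\mathbf{A}_1=\mathbf{I}$ the identity matrix. Products are ordered from left to right with increasing index: $\prod_{k=1}^{K}\mathbf{M}_k = \mathbf{M}_1\mathbf{M}_2\cdots\mathbf{M}_K$. *)

theory Defs
  imports
    "HOL-Analysis.Analysis"
    "Jordan_Normal_Form.Determinant"
    "Jordan_Normal_Form.Gauss_Jordan_Elimination"
begin

definition dft_mat :: "nat \<Rightarrow> complex mat" where
  "dft_mat N = mat N N (\<lambda>(j, k).
     exp (- (2 * of_real pi * \<i> * of_nat j * of_nat k / of_nat N)))"

(* mat_inverse returns an option; dft_mat_inverse below shows that it is not None here. *)
definition dft_inv :: "nat \<Rightarrow> complex mat" where
  "dft_inv N = the (mat_inverse (dft_mat N))"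

(* Ordered product M 1 * M 2 * ... * M K of N x N matrices. *)
primrec mat_prod :: "nat \<Rightarrow> (nat \<Rightarrow> complex mat) \<Rightarrow> nat \<Rightarrow> complex mat" where
  "mat_prod N M 0 = 1\<^sub>m N"
| "mat_prod N M (Suc K) = mat_prod N M K * M (Suc K)"

(* The matrix by which an order-K AFDF transform acts on row vectors from the right. *)
definition afdf_mat ::
  "nat \<Rightarrow> nat \<Rightarrow> (nat \<Rightarrow> complex mat) \<Rightarrow> (nat \<Rightarrow> complex mat) \<Rightarrow> complex mat" where
  "afdf_mat N K A D = mat_prod N (\<lambda>k. A k * dft_mat N * D k * dft_inv N) K"

(* A norm on the complex vector space of N x N matrices; values off the carrier are irrelevant. *)
definition is_norm_on_mat :: "nat \<Rightarrow> (complex mat \<Rightarrow> real) \<Rightarrow> bool" where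
  "is_norm_on_mat N \<nu> \<longleftrightarrow>
     (\<forall>X \<in> carrier_mat N N. 0 \<le> \<nu> X \<and> (\<nu> X = 0 \<longleftrightarrow> X = 0\<^sub>m N N)) \<and>
     (\<forall>X \<in> carrier_mat N N. \<forall>c. \<nu> (c \<cdot>\<^sub>m X) = cmod c * \<nu> X) \<and>
     (\<forall>X \<in> carrier_mat N N. \<forall>Y \<in> carrier_mat N N. \<nu> (X + Y) \<le> \<nu> X + \<nu> Y)"

lemma dft_mat_carrier: "dft_mat N \<in> carrier_mat N N"
  by (simp add: dft_mat_def)

lemma dft_orthogonality:
  assumes "i < N" "j < N"
  shows "(\<Sum>k<N. exp (- (2 * of_real pi * \<i> * of_nat i * of_nat k / of_nat N)) *
                  exp (2 * of_real pi * \<i> * of_nat k * of_nat j / of_nat N)) =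
         (if i = j then of_nat N else (0::complex))"
proof -
  define w where "w = exp (2 * of_real pi * \<i> * (of_nat j - of_nat i) / of_nat N :: complex)"
  have term_eq: "exp (- (2 * of_real pi * \<i> * of_nat i * of_nat k / of_nat N)) *
        exp (2 * of_real pi * \<i> * of_nat k * of_nat j / of_nat N) = w ^ k" for k
    unfolding w_def exp_of_nat_mult[symmetric] exp_add[symmetric]
    by (rule arg_cong[where f = exp]) (simp add: algebra_simps diff_divide_distrib)
  have sum_eq: "(\<Sum>k<N. exp (- (2 * of_real pi * \<i> * of_nat i * of_nat k / of_nat N)) *
      exp (2 * of_real pi * \<i> * of_nat k * of_nat j / of_nat N)) = (\<Sum>k<N. w ^ k)"
    by (simp only: term_eq)
  show ?thesis
  proof (cases "i = j")
    case True
    then have "w = 1" by (simp add: w_def)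
    with True show ?thesis unfolding sum_eq by simp
  next
    case False
    have "w \<noteq> 1"
    proof
      assume "w = 1"
      then obtain n :: int where
        "Im (2 * of_real pi * \<i> * (of_nat j - of_nat i) / of_nat N) = of_int (2 * n) * pi"
        unfolding w_def exp_eq_1 by blast
      then have "pi * (2 * (real j - real i)) = pi * (2 * (of_int n * real N))"
        using assms by (simp add: field_simps)
      then have "real j - real i = of_int n * real N" by simp
      then have "real_of_int (int j - int i) = real_of_int (n * int N)" by simp
      then have eq: "int j - int i = n * int N" by (simp only: of_int_eq_iff)
      then have "int N dvd int j - int i" by simp
      moreover have "\<bar>int j - int i\<bar> < int N" using assms by linarith
      ultimately show False
        using False dvd_imp_le_int[of "int j - int i" "int N"] by linarith
    qed
    moreover have "w ^ N = 1"
    proof -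
      have "w ^ N = exp (of_nat N * (2 * of_real pi * \<i> * (of_nat j - of_nat i) / of_nat N))"
        unfolding w_def exp_of_nat_mult ..
      also have "\<dots> = exp ((2 * of_int (int j - int i) * pi) * \<i>)"
        using assms by (intro arg_cong[where f = exp]) (simp add: field_simps)
      also have "\<dots> = 1" by (rule exp_integer_2pi) simp
      finally show ?thesis .
    qed
    ultimately have "(\<Sum>k<N. w ^ k) = 0" by (simp add: geometric_sum)
    with False show ?thesis unfolding sum_eq by simp
  qed
qed

lemma dft_mat_inverse:
  "mat_inverse (dft_mat N) = Some (dft_inv N)"
  "dft_inv N \<in> carrier_mat N N"
  "dft_mat N * dft_inv N = 1\<^sub>m N"
  "dft_inv N * dft_mat N = 1\<^sub>m N"
proof -
  define B where "B = mat N N (\<lambda>(j, k).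
     exp (2 * of_real pi * \<i> * of_nat j * of_nat k / of_nat N) / of_nat N :: complex)"
  have B: "B \<in> carrier_mat N N" by (simp add: B_def)
  have "dft_mat N * B = 1\<^sub>m N"
  proof (rule eq_matI)
    fix i j assume "i < dim_row (1\<^sub>m N :: complex mat)" "j < dim_col (1\<^sub>m N :: complex mat)"
    then have ij: "i < N" "j < N" by auto
    have "(dft_mat N * B) $$ (i, j) =
      (\<Sum>k<N. exp (- (2 * of_real pi * \<i> * of_nat i * of_nat k / of_nat N)) *
             exp (2 * of_real pi * \<i> * of_nat k * of_nat j / of_nat N)) / of_nat N"
      using ij by (simp add: dft_mat_def B_def scalar_prod_def sum_divide_distrib atLeast0LessThan)
    then show "(dft_mat N * B) $$ (i, j) = 1\<^sub>m N $$ (i, j)"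
      using ij by (simp only: dft_orthogonality) simp
  qed (simp_all add: dft_mat_def B_def)
  moreover from this have "B * dft_mat N = 1\<^sub>m N"
    using mat_mult_left_right_inverse[OF dft_mat_carrier B] by simp
  ultimately have "dft_mat N \<in> Units (ring_mat TYPE(complex) N ())"
    using dft_mat_carrier B by (auto simp: Units_def ring_mat_def)
  then have "mat_inverse (dft_mat N) \<noteq> None"
    using mat_inverse(1)[OF dft_mat_carrier, where b = "()"] by blast
  then show *: "mat_inverse (dft_mat N) = Some (dft_inv N)"
    by (auto simp: dft_inv_def)
  show "dft_inv N \<in> carrier_mat N N"
    "dft_mat N * dft_inv N = 1\<^sub>m N"
    "dft_inv N * dft_mat N = 1\<^sub>m N"
    using mat_inverse(2)[OF dft_mat_carrier *] by auto
qed

end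

theory Submission
  imports Defs "Jordan_Normal_Form.Spectral_Radius"
begin

text \<open>
  With \<open>P\<close> the cyclic shift, every matrix is a sum \<open>\<Sum>j<N. D\<^sub>j P\<^sup>j\<close> with diagonal \<open>D\<^sub>j\<close>, that is, a
  skew polynomial of degree \<open>N - 1\<close> evaluated at \<open>P\<close>. A linear factor \<open>X - E\<close> can be split off on the
  right whenever the recurrence \<open>\<Sum>j. d j i * v (i + j) = 0\<close> has a nowhere vanishing solution with
  \<open>v (i + N) = \<mu> * v i\<close>: take \<open>E i = v (i + 1) / v i\<close>. An eigenvector of the monodromy matrix gives a
  nonzero solution of this kind, and an arbitrarily small change of the coefficients makes it nowhere
  zero. Hence, by induction on the degree, products of a diagonal matrix and \<open>N - 1\<close> linear factors
  are dense. Each linear factor with nonzero coefficients is diagonally equivalent to some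
  \<open>1 + \<alpha> P\<close>, which the discrete Fourier transform diagonalizes.
\<close>

subsection \<open>Quasi-periodic solutions of periodic recurrences\<close>

text \<open>The recurrence is a first-order system for the state
  \<open>(v i, ..., v (i + n - 1))\<close>. An eigenvector of the product of its transfer matrices
  over one period, taken as initial state, is multiplied by \<open>\<mu>\<close> after each
  period.\<close>

lemma floquet_solution:
  fixes d :: "nat \<Rightarrow> nat \<Rightarrow> complex"
  assumes n: "n > 0" and per: "\<And>j i. d j (i + N) = d j i" and nz: "\<And>i. d n i \<noteq> 0"
  obtains v :: "nat \<Rightarrow> complex" and \<mu> :: complex
  where "\<And>i. v (i + N) = \<mu> * v i" "\<And>i. (\<Sum>j\<le>n. d j i * v (i + j)) = 0" "\<exists>i. v i \<noteq> 0"
proof -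
  \<comment> \<open>Companion matrix: all rows but the last shift the state, and the last row solves
    equation \<open>i\<close> for \<open>v (i + n)\<close>.\<close>
  define T where "T i = mat n n (\<lambda>(k, l). if Suc k < n then (if l = Suc k then 1 else 0)
      else - d l i / d n i)" for i
  have T: "T i \<in> carrier_mat n n" for i
    by (simp add: T_def)
  define \<Phi> where "\<Phi> = rec_nat (1\<^sub>m n) (\<lambda>i M. T i * M)"
  have \<Phi>0: "\<Phi> 0 = 1\<^sub>m n" and \<Phi>Suc: "\<Phi> (Suc i) = T i * \<Phi> i" for i
    by (simp_all add: \<Phi>_def)
  have \<Phi>: "\<Phi> i \<in> carrier_mat n n" for i
  proof (induction i)
    case (Suc i)
    show ?case unfolding \<Phi>Suc by (rule mult_carrier_mat[OF T Suc])
  qed (simp add: \<Phi>0)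
  \<comment> \<open>By periodicity the transfer matrices applied after time \<open>N\<close> repeat
    those applied from time 0, so \<open>\<Phi> N\<close> is the monodromy matrix.\<close>
  have \<Phi>_shift: "\<Phi> (i + N) = \<Phi> i * \<Phi> N" for i
  proof (induction i)
    case 0
    then show ?case using \<Phi>[of N] by (simp add: \<Phi>0)
  next
    case (Suc i)
    have "T (i + N) = T i"
      by (simp only: T_def per)
    then have "\<Phi> (Suc i + N) = T i * (\<Phi> i * \<Phi> N)"
      using Suc by (simp add: \<Phi>Suc)
    also have "\<dots> = \<Phi> (Suc i) * \<Phi> N"
      unfolding \<Phi>Suc by (rule assoc_mult_mat[OF T \<Phi> \<Phi>, symmetric])
    finally show ?case .
  qed
  obtain \<mu> where "eigenvalue (\<Phi> N) \<mu>"
    using spectrum_non_empty[OF \<Phi>[of N] n] by (auto simp: spectrum_def)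
  then obtain u where u: "u \<in> carrier_vec n" "u \<noteq> 0\<^sub>v n" and eig: "\<Phi> N *\<^sub>v u = \<mu> \<cdot>\<^sub>v u"
    using \<Phi>[of N] by (auto simp: eigenvalue_def eigenvector_def)
  define x where "x i = \<Phi> i *\<^sub>v u" for i
  have x: "x i \<in> carrier_vec n" for i
    unfolding x_def by (rule mult_mat_vec_carrier[OF \<Phi> u(1)])
  have x_shift: "x (i + N) = \<mu> \<cdot>\<^sub>v x i" for i
    by (simp add: x_def \<Phi>_shift assoc_mult_mat_vec[OF \<Phi> \<Phi> u(1)] eig mult_mat_vec[OF \<Phi> u(1)])
  have x_Suc: "x (Suc i) = T i *\<^sub>v x i" for i
    unfolding x_def \<Phi>Suc by (rule assoc_mult_mat_vec[OF T \<Phi> u(1)])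
  have x_entry: "vec_index (x (Suc i)) k = (\<Sum>l<n. T i $$ (k, l) * vec_index (x i) l)" if "k < n" for i k
    using that x[of i] T[of i]
    by (auto simp: x_Suc scalar_prod_def atLeast0LessThan)
  have x_shift1: "vec_index (x (Suc i)) k = vec_index (x i) (Suc k)" if "Suc k < n" for i k
  proof -
    have "vec_index (x (Suc i)) k = (\<Sum>l<n. if l = Suc k then vec_index (x i) l else 0)"
      unfolding x_entry[OF Suc_lessD[OF that]]
      by (intro sum.cong) (use that in \<open>auto simp: T_def\<close>)
    also have "\<dots> = vec_index (x i) (Suc k)"
      using that by simp
    finally show ?thesis .
  qed
  define v where "v i = vec_index (x i) 0" for i
  have x_v: "vec_index (x i) k = v (i + k)" if "k < n" for i k
    using that
  proof (induction k arbitrary: i)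
    case (Suc k)
    then show ?case using x_shift1[of k i] by simp
  qed (simp add: v_def)
  show thesis
  proof (rule that)
    show "v (i + N) = \<mu> * v i" for i
      using x[of i] n by (simp add: v_def x_shift)
    show "(\<Sum>j\<le>n. d j i * v (i + j)) = 0" for i
    proof -
      have "v (i + n) = vec_index (x (Suc i)) (n - 1)"
        using n by (subst x_v) auto
      also have "\<dots> = (\<Sum>l<n. - d l i / d n i * v (i + l))"
        using n by (subst x_entry) (auto simp: T_def x_v intro!: sum.cong)
      finally have "d n i * v (i + n) = (\<Sum>l<n. - (d l i * v (i + l)))"
        using nz[of i] by (simp add: sum_distrib_left)
      then show ?thesis
        by (simp add: lessThan_Suc_atMost[symmetric] sum_negf)
    qed
    show "\<exists>i. v i \<noteq> 0"
    proof (rule ccontr)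
      assume "\<not> ?thesis"
      then have "vec_index (x 0) k = 0" if "k < n" for k
        using x_v[OF that] by simp
      then have "x 0 = 0\<^sub>v n"
        using x[of 0] by (intro eq_vecI) auto
      then show False
        using u by (simp add: x_def \<Phi>0)
    qed
  qed
qed

text \<open>If all values after \<open>i\<close> vanish, equation \<open>i\<close> reduces to
  \<open>d 0 i * v i = 0\<close>; this lowers the threshold one index at a time.\<close>

lemma recurrence_backward_zero:
  fixes d :: "nat \<Rightarrow> nat \<Rightarrow> complex"
  assumes rec: "\<And>i. (\<Sum>j\<le>n. d j i * v (i + j)) = 0" and nz: "\<And>i. d 0 i \<noteq> 0"
    and zero: "\<And>k. k \<ge> i \<Longrightarrow> v k = 0"
  shows "v k = 0"
  using zero
proof (induction i)
  case (Suc i)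
  have "(\<Sum>j\<le>n. d j i * v (i + j)) = (\<Sum>j\<in>{0}. d j i * v (i + j))"
    using Suc.prems by (intro sum.mono_neutral_right) auto
  then have "v i = 0"
    using rec[of i] nz[of i] by simp
  then show ?case
    using Suc by (metis le_antisym not_less_eq_eq)
qed auto

text \<open>The equation whose top term is \<open>v (i + k)\<close> involves otherwise only earlier
  values, which vanish by induction.\<close>

lemma recurrence_forward_zero:
  fixes d :: "nat \<Rightarrow> nat \<Rightarrow> complex"
  assumes rec: "\<And>i. (\<Sum>j\<le>n. d j i * v (i + j)) = 0" and nz: "\<And>i. d n i \<noteq> 0"
    and zero: "\<And>j. j < n \<Longrightarrow> v (i + j) = 0"
  shows "v (i + k) = 0"
proof (induction k rule: less_induct)
  case (less k)
  show ?case
  proof (cases "k < n")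
    case False
    have "(\<Sum>j\<le>n. d j (i + (k - n)) * v (i + (k - n) + j))
        = (\<Sum>j\<in>{n}. d j (i + (k - n)) * v (i + (k - n) + j))"
    proof (intro sum.mono_neutral_right ballI)
      fix j assume "j \<in> {..n} - {n}"
      then have "v (i + (k - n + j)) = 0"
        using False by (intro less) auto
      then show "d j (i + (k - n)) * v (i + (k - n) + j) = 0"
        by (simp add: add.assoc)
    qed auto
    then show ?thesis
      using rec[of "i + (k - n)"] nz[of "i + (k - n)"] False by simp
  qed (rule zero)
qed

text \<open>The coefficients of one equation are changed in the single position \<open>p i\<close> at which the
  solution does not vanish; this absorbs the residual created by moving the zeros of the solution.\<close>

lemma perturb_to_nonvanishing_solution:
  fixes d :: "nat \<Rightarrow> nat \<Rightarrow> complex"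
  assumes n: "n > 0" and N: "N > 0" and per: "\<And>j i. d j (i + N) = d j i" and \<epsilon>: "\<epsilon> > 0"
  obtains c v \<mu> where "\<And>j i. c j (i + N) = c j i" "\<And>j i. cmod (d j i - c j i) < \<epsilon>"
    "\<And>i. v (i + N) = \<mu> * v i" "\<And>i. v i \<noteq> 0" "\<And>i. (\<Sum>j\<le>n. c j i * v (i + j)) = 0"
proof -
  \<comment> \<open>Making every coefficient nonzero allows solving the recurrence in both
    directions. This spends a quarter of the tolerance.\<close>
  define b where "b j i = (if d j i = 0 then complex_of_real (\<epsilon> / 4) else d j i)" for j i
  have b_per: "b j (i + N) = b j i" and b_nz: "b j i \<noteq> 0"
    and b_close: "cmod (d j i - b j i) \<le> \<epsilon> / 4" for i j
    using \<epsilon> by (auto simp: b_def per norm_divide)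
  obtain u \<mu> where u_per: "\<And>i. u (i + N) = \<mu> * u i"
    and u_rec: "\<And>i. (\<Sum>j\<le>n. b j i * u (i + j)) = 0" and u_nz: "\<exists>i. u i \<noteq> 0"
    using floquet_solution[of n b N] n b_per b_nz by metis
  have \<mu>: "\<mu> \<noteq> 0"
  proof
    assume "\<mu> = 0"
    then have "u k = 0" if "k \<ge> N" for k
      using u_per[of "k - N"] that by simp
    then show False
      using recurrence_backward_zero[where v = u and d = b] u_rec b_nz u_nz by blast
  qed
  \<comment> \<open>A window of zeros would spread forward to all later indices and then backward to
    all indices.\<close>
  have "\<exists>j\<le>n. u (i + j) \<noteq> 0" for i
  proof (rule ccontr)
    assume *: "\<not> ?thesis"
    have "u (i + k) = 0" for k
      by (rule recurrence_forward_zero[where d = b and n = n]) (use u_rec b_nz * in auto)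
    then have "u k = 0" if "k \<ge> i" for k
      using that by (metis le_add_diff_inverse)
    then show False
      using recurrence_backward_zero[where v = u and d = b] u_rec b_nz u_nz by blast
  qed
  then obtain p' where p': "\<And>i. p' i \<le> n \<and> u (i + p' i) \<noteq> 0"
    by metis
  \<comment> \<open>Choosing the position by residue makes it periodic. It still hits a nonzero
    value, since moving by a period only multiplies \<open>u\<close> by the nonzero
    \<open>\<mu>\<close>.\<close>
  define p where "p i = p' (i mod N)" for i
  have p_per: "p (i + N) = p i" for i
    by (simp add: p_def)
  have u_shift: "u (i + k * N) = \<mu> ^ k * u i" for i k
    by (induction k) (use u_per in \<open>simp_all add: add.assoc[symmetric] add.commute[of N]\<close>)
  have p_nz: "u (i + p i) \<noteq> 0" and p_le: "p i \<le> n" for i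
  proof -
    have "u (i + p i) = u ((i mod N + p i) + (i div N) * N)"
      by (simp add: add.assoc add.commute[of "p i"]) 
    also have "\<dots> = \<mu> ^ (i div N) * u (i mod N + p i)"
      by (rule u_shift)
    finally show "u (i + p i) \<noteq> 0"
      using p' \<mu> by (simp add: p_def)
    show "p i \<le> n" using p' by (simp add: p_def)
  qed
  \<comment> \<open>\<open>w\<close> lives exactly on the zeros of \<open>u\<close> and has the same
    multiplier, so \<open>u + t * w\<close> is quasi-periodic and nowhere zero for every nonzero
    \<open>t\<close>.\<close>
  define w where "w i = (if u i = 0 then \<mu> ^ (i div N) else 0)" for i
  have w_per: "w (i + N) = \<mu> * w i" for i
    using \<mu> N by (simp add: w_def u_per)
  have w_p: "w (i + p i) = 0" for i
    using p_nz by (simp add: w_def)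
  \<comment> \<open>Adding \<open>t * w\<close> leaves the residual
    \<open>t * r i * u (i + p i)\<close> in equation \<open>i\<close>. As \<open>w\<close> vanishes
    at \<open>i + p i\<close>, lowering the coefficient at \<open>p i\<close> by
    \<open>t * r i\<close> cancels it. Numerator and denominator both scale by \<open>\<mu>\<close>,
    so \<open>r\<close> is periodic.\<close>
  define r where "r i = (\<Sum>j\<le>n. b j i * w (i + j)) / u (i + p i)" for i
  have r_per: "r (i + N) = r i" for i
  proof -
    have swap: "i + N + j = (i + j) + N" for j by simp
    have "(\<Sum>j\<le>n. b j (i + N) * w (i + N + j)) = \<mu> * (\<Sum>j\<le>n. b j i * w (i + j))"
      unfolding swap w_per b_per sum_distrib_left by (simp add: ac_simps)
    moreover have "u (i + N + p (i + N)) = \<mu> * u (i + p i)"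
      unfolding swap p_per u_per ..
    ultimately show ?thesis using \<mu> by (simp add: r_def)
  qed
  define R where "R = (\<Sum>i<N. cmod (r i))"
  have R: "R \<ge> 0" by (simp add: R_def sum_nonneg)
  have r_le: "cmod (r i) \<le> R" for i
  proof -
    have "r (k + l * N) = r k" for k l
      by (induction l) (use r_per in \<open>simp_all add: add.assoc[symmetric] add.commute[of N]\<close>)
    from this[of "i mod N" "i div N"] have "r i = r (i mod N)" by simp
    then show ?thesis
      using member_le_sum[of "i mod N" "{..<N}" "\<lambda>i. cmod (r i)"] N by (simp add: R_def)
  qed
  \<comment> \<open>Chosen so that \<open>t * R < \<epsilon> / 2\<close>; the added 1 covers
    \<open>R = 0\<close>.\<close>
  define t where "t = \<epsilon> / (2 * (R + 1))"
  have t: "t > 0" using \<epsilon> R by (simp add: t_def)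
  have tr: "cmod (of_real t * r i) < \<epsilon> / 2" for i
  proof -
    have "cmod (of_real t * r i) \<le> t * R"
      using t r_le[of i] by (simp add: norm_mult)
    also have "\<dots> < \<epsilon> / 2"
      using \<epsilon> R by (simp add: t_def field_simps)
    finally show ?thesis .
  qed
  define c where "c j i = b j i - (if j = p i then of_real t * r i else 0)" for j i
  define v where "v i = u i + of_real t * w i" for i
  show thesis
  proof (rule that)
    show "c j (i + N) = c j i" for i j
      by (simp add: c_def b_per p_per r_per)
    show "cmod (d j i - c j i) < \<epsilon>" for i j
    proof -
      have "d j i - c j i = (d j i - b j i) + (if j = p i then of_real t * r i else 0)"
        by (simp add: c_def)
      also have "cmod \<dots> \<le> \<epsilon> / 4 + cmod (if j = p i then of_real t * r i else 0)"
        by (rule norm_triangle_le) (use b_close in auto)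
      also have "\<dots> < \<epsilon>"
        using tr[of i] \<epsilon> by auto
      finally show ?thesis .
    qed
    show "v (i + N) = \<mu> * v i" for i
      unfolding v_def u_per w_per by (simp add: algebra_simps)
    show "v i \<noteq> 0" for i
      using t \<mu> by (simp add: v_def w_def)
    show "(\<Sum>j\<le>n. c j i * v (i + j)) = 0" for i
    proof -
      have "(\<Sum>j\<le>n. c j i * v (i + j)) = (\<Sum>j\<le>n. b j i * u (i + j) + of_real t * (b j i * w (i + j))
          - (if j = p i then of_real t * r i * v (i + j) else 0))"
        by (intro sum.cong) (auto simp: c_def v_def algebra_simps)
      also have "\<dots> = (\<Sum>j\<le>n. b j i * u (i + j)) + of_real t * (\<Sum>j\<le>n. b j i * w (i + j))
          - of_real t * r i * v (i + p i)"
        using p_le by (simp add: sum.distrib sum_subtractf sum_distrib_left)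
      also have "\<dots> = 0"
        using u_rec[of i] p_nz[of i] w_p[of i] by (simp add: r_def v_def)
      finally show ?thesis .
    qed
  qed
qed

text \<open>This is right division by \<open>X - e\<close> in the skew polynomial ring where
  \<open>X\<close> moves past a coefficient by shifting its index. With
  \<open>e i = v (i + 1) / v i\<close> the remainder is the left side of the recurrence at
  \<open>i\<close>, up to the factor \<open>v i\<close>, hence zero.\<close>

lemma perturb_to_right_factor:
  fixes d :: "nat \<Rightarrow> nat \<Rightarrow> complex"
  assumes N: "N > 0" and per: "\<And>j i. d j (i + N) = d j i" and \<epsilon>: "\<epsilon> > 0"
  obtains q e where "\<And>j i. q j (i + N) = q j i" "\<And>i. e (i + N) = e i" "\<And>i. e i \<noteq> 0"
    "\<And>j i. j \<le> Suc m \<Longrightarrow> cmod (d j i -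
       ((if j = 0 then 0 else q (j - 1) i) - (if j = Suc m then 0 else q j i * e (i + j)))) < \<epsilon>"
proof -
  obtain c v \<mu> where c: "\<And>j i. c j (i + N) = c j i" "\<And>j i. cmod (d j i - c j i) < \<epsilon>"
    and v: "\<And>i. v (i + N) = \<mu> * v i" "\<And>i. v i \<noteq> 0"
    and rec: "\<And>i. (\<Sum>j\<le>Suc m. c j i * v (i + j)) = 0"
    using perturb_to_nonvanishing_solution[of "Suc m" N d, OF _ N per \<epsilon>] by blast
  have \<mu>: "\<mu> \<noteq> 0" using v(1)[of 0] v(2)[of N] by auto
  \<comment> \<open>Tail sums of the recurrence: consecutive ones differ by
    \<open>c j i * v (i + j)\<close>, and divided by values of \<open>v\<close> they are the
    coefficients of the quotient.\<close>
  define s where "s j i = (\<Sum>l=j..Suc m. c l i * v (i + l))" for j i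
  define q where "q j i = s (Suc j) i / v (Suc (i + j))" for j i
  define e where "e i = v (Suc i) / v i" for i
  have swap: "i + N + l = (i + l) + N" for i l by simp
  have swap': "Suc (i + N) = Suc i + N" for i by simp
  show thesis
  proof (rule that[of q e])
    have "s j (i + N) = \<mu> * s j i" for i j
      unfolding s_def swap v c(1) sum_distrib_left by (simp add: ac_simps)
    then show "q j (i + N) = q j i" for i j
      unfolding q_def swap swap' v using \<mu> by simp
    show "e (i + N) = e i" for i
      unfolding e_def swap' v using \<mu> by simp
    show "e i \<noteq> 0" for i
      by (simp add: e_def v)
    show "cmod (d j i -
       ((if j = 0 then 0 else q (j - 1) i) - (if j = Suc m then 0 else q j i * e (i + j)))) < \<epsilon>"
      if "j \<le> Suc m" for j i
    proof -
      have s_eq: "s j i = c j i * v (i + j) + s (Suc j) i"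
        unfolding s_def using that by (rule sum.atLeast_Suc_atMost)
      \<comment> \<open>At \<open>j = 0\<close> this says \<open>s 0 i = 0\<close>, which is the
        recurrence itself; in the next equation the case \<open>j = Suc m\<close> is an empty
        tail.\<close>
      have 1: "(if j = 0 then 0 else q (j - 1) i) = s j i / v (i + j)"
      proof (cases j)
        case 0
        then show ?thesis using rec[of i] by (simp add: s_def atMost_atLeast0)
      qed (simp add: q_def)
      have 2: "(if j = Suc m then 0 else q j i * e (i + j)) = s (Suc j) i / v (i + j)"
        using v(2) by (simp add: q_def e_def s_def)
      show ?thesis
        unfolding 1 2 using s_eq v(2)[of "i + j"] c(2)[of j i] by (simp add: add_divide_distrib)
    qed
  qed
qed

subsection \<open>Approximation of matrices\<close>

text \<open>This norm is submultiplicative and dominates every norm up to a constant factor, so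
  density is proved in it and transferred at the end.\<close>

definition entry_norm :: "nat \<Rightarrow> complex mat \<Rightarrow> real" where
  "entry_norm N X = (\<Sum>i<N. \<Sum>j<N. cmod (X $$ (i, j)))"

lemma entry_norm_nonneg: "entry_norm N X \<ge> 0"
  by (simp add: entry_norm_def sum_nonneg)

lemma entry_norm_triangle:
  assumes "X \<in> carrier_mat N N" "Y \<in> carrier_mat N N" "Z \<in> carrier_mat N N"
  shows "entry_norm N (X - Z) \<le> entry_norm N (X - Y) + entry_norm N (Y - Z)"
  unfolding entry_norm_def sum.distrib[symmetric]
  using assms by (intro sum_mono) (auto simp: norm_diff_triangle_ineq intro: norm_diff_triangle_le)

lemma entry_norm_mult:
  assumes X: "X \<in> carrier_mat N N" and Y: "Y \<in> carrier_mat N N"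
  shows "entry_norm N (X * Y) \<le> entry_norm N X * entry_norm N Y"
proof -
  have "entry_norm N (X * Y) \<le> (\<Sum>i<N. \<Sum>j<N. \<Sum>k<N. cmod (X $$ (i, k)) * cmod (Y $$ (k, j)))"
    unfolding entry_norm_def
  proof (intro sum_mono)
    fix i j assume "i \<in> {..<N}" "j \<in> {..<N}"
    then have "(X * Y) $$ (i, j) = (\<Sum>k<N. X $$ (i, k) * Y $$ (k, j))"
      using X Y by (auto simp: scalar_prod_def atLeast0LessThan)
    then show "cmod ((X * Y) $$ (i, j)) \<le> (\<Sum>k<N. cmod (X $$ (i, k)) * cmod (Y $$ (k, j)))"
      by (auto simp: norm_mult intro!: sum_norm_le)
  qed
  also have "\<dots> = (\<Sum>i<N. \<Sum>k<N. cmod (X $$ (i, k)) * (\<Sum>j<N. cmod (Y $$ (k, j))))"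
    unfolding sum_distrib_left by (intro sum.cong refl sum.swap)
  also have "\<dots> \<le> (\<Sum>i<N. \<Sum>k<N. cmod (X $$ (i, k)) * entry_norm N Y)"
    unfolding entry_norm_def[of N Y]
    by (intro sum_mono mult_left_mono member_le_sum[where f = "\<lambda>k. \<Sum>j<N. cmod (Y $$ (k, j))"])
       (auto intro: sum_nonneg)
  also have "\<dots> = entry_norm N X * entry_norm N Y"
    by (simp add: entry_norm_def sum_distrib_right)
  finally show ?thesis .
qed

text \<open>Expand \<open>X\<close> in the matrix units \<open>E p\<close> and apply the triangle
  inequality and homogeneity.\<close>

lemma norm_on_mat_le_entry_norm:
  assumes \<nu>: "is_norm_on_mat N \<nu>"
  obtains C where "C > 0" "\<And>X. X \<in> carrier_mat N N \<Longrightarrow> \<nu> X \<le> C * entry_norm N X"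
proof -
  define E where "E p = mat N N (\<lambda>q. if q = p then 1 else 0 :: complex)" for p
  have E: "E p \<in> carrier_mat N N" for p by (simp add: E_def)
  define C where "C = 1 + (\<Sum>p\<in>{..<N} \<times> {..<N}. \<nu> (E p))"
  have E_nonneg: "0 \<le> \<nu> (E p)" for p
    using \<nu> E by (simp add: is_norm_on_mat_def)
  show thesis
  proof (rule that)
    show "C > 0"
      unfolding C_def using E_nonneg by (intro add_pos_nonneg sum_nonneg) auto
    fix X :: "complex mat" assume X: "X \<in> carrier_mat N N"
    \<comment> \<open>\<open>X\<close> restricted to the positions in \<open>I\<close>, so that the
      expansion can be built by induction on a finite set of positions.\<close>
    define R where "R I = mat N N (\<lambda>q. if q \<in> I then X $$ q else 0)" for I
    have "\<nu> (R I) \<le> (\<Sum>p\<in>I. cmod (X $$ p) * \<nu> (E p))" if "finite I" for I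
      using that
    proof (induction I)
      case empty
      have "R {} = 0\<^sub>m N N" by (auto simp: R_def)
      moreover have "\<nu> (0\<^sub>m N N) = 0"
        using \<nu> zero_carrier_mat[of N N] unfolding is_norm_on_mat_def by blast
      ultimately show ?case by simp
    next
      case (insert p I)
      have "R (insert p I) = (X $$ p) \<cdot>\<^sub>m E p + R I"
        using insert(2) by (auto simp: R_def E_def)
      moreover have "R I \<in> carrier_mat N N" by (simp add: R_def)
      ultimately have "\<nu> (R (insert p I)) \<le> cmod (X $$ p) * \<nu> (E p) + \<nu> (R I)"
        using \<nu> E unfolding is_norm_on_mat_def by (metis smult_carrier_mat)
      then show ?case using insert by simp
    qed
    moreover have "R ({..<N} \<times> {..<N}) = X"
      using X by (auto simp: R_def)
    ultimately have "\<nu> X \<le> (\<Sum>p\<in>{..<N} \<times> {..<N}. cmod (X $$ p) * \<nu> (E p))"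
      by (metis finite_SigmaI finite_lessThan)
    also have "\<dots> \<le> (\<Sum>p\<in>{..<N} \<times> {..<N}. cmod (X $$ p) * C)"
    proof (intro sum_mono mult_left_mono)
      fix p assume "p \<in> {..<N} \<times> {..<N}"
      then have "\<nu> (E p) \<le> (\<Sum>p\<in>{..<N} \<times> {..<N}. \<nu> (E p))"
        using E_nonneg by (intro member_le_sum) auto
      then show "\<nu> (E p) \<le> C" by (simp add: C_def)
    qed simp
    also have "\<dots> = C * entry_norm N X"
      by (simp add: entry_norm_def sum.cartesian_product sum_distrib_left mult.commute)
    finally show "\<nu> X \<le> C * entry_norm N X" .
  qed
qed

section \<open>Closure of sets of matrices in the entrywise norm\<close>

definition mat_closure :: "nat \<Rightarrow> complex mat set \<Rightarrow> complex mat set" where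
  "mat_closure N S = {X \<in> carrier_mat N N.
     \<forall>\<epsilon>>0. \<exists>Y\<in>S. Y \<in> carrier_mat N N \<and> entry_norm N (X - Y) < \<epsilon>}"

lemma mat_closureI:
  assumes "X \<in> carrier_mat N N"
    and "\<And>\<epsilon>. \<epsilon> > 0 \<Longrightarrow> \<exists>Y\<in>S. Y \<in> carrier_mat N N \<and> entry_norm N (X - Y) < \<epsilon>"
  shows "X \<in> mat_closure N S"
  using assms by (simp add: mat_closure_def)

lemma mat_closureD:
  assumes "X \<in> mat_closure N S"
  shows "X \<in> carrier_mat N N"
    and "\<epsilon> > 0 \<Longrightarrow> \<exists>Y\<in>S. Y \<in> carrier_mat N N \<and> entry_norm N (X - Y) < \<epsilon>"
  using assms by (auto simp: mat_closure_def)

lemma mat_closure_superset: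
  assumes "X \<in> S" "X \<in> carrier_mat N N"
  shows "X \<in> mat_closure N S"
proof (rule mat_closureI)
  have "entry_norm N (X - X) = 0"
    using assms by (simp add: entry_norm_def)
  then show "\<exists>Y\<in>S. Y \<in> carrier_mat N N \<and> entry_norm N (X - Y) < \<epsilon>" if "\<epsilon> > 0" for \<epsilon>
    using assms that by (intro bexI[of _ X]) auto
qed (rule assms)

text \<open>Two approximations within \<open>\<epsilon> / 2\<close> compose. This lets the induction
  on the degree approximate by a factorization first and then approximate the quotient.\<close>

lemma mat_closure_idem:
  assumes X: "X \<in> mat_closure N T" and T: "T \<subseteq> mat_closure N S"
  shows "X \<in> mat_closure N S"
proof (rule mat_closureI[OF mat_closureD(1)[OF X]])
  fix \<epsilon> :: real assume "\<epsilon> > 0"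
  then obtain Y where Y: "Y \<in> T" "Y \<in> carrier_mat N N" "entry_norm N (X - Y) < \<epsilon> / 2"
    using mat_closureD(2)[OF X, of "\<epsilon> / 2"] by auto
  then obtain Z where "Z \<in> S" "Z \<in> carrier_mat N N" "entry_norm N (Y - Z) < \<epsilon> / 2"
    using mat_closureD(2)[of Y N S "\<epsilon> / 2"] T \<open>\<epsilon> > 0\<close> by auto
  then show "\<exists>Z\<in>S. Z \<in> carrier_mat N N \<and> entry_norm N (X - Z) < \<epsilon>"
    using entry_norm_triangle[OF mat_closureD(1)[OF X], of Y Z] Y by (intro bexI[of _ Z]) auto
qed

text \<open>Two-sided multiplication by fixed matrices is continuous, by submultiplicativity of the
  norm.\<close>

lemma mat_closure_mult:
  assumes X: "X \<in> mat_closure N S" and P: "P \<in> carrier_mat N N" and Q: "Q \<in> carrier_mat N N"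
  shows "P * X * Q \<in> mat_closure N ((\<lambda>Y. P * Y * Q) ` S)"
proof (rule mat_closureI)
  note XC = mat_closureD(1)[OF X]
  show "P * X * Q \<in> carrier_mat N N"
    using XC P Q by simp
  fix \<epsilon> :: real assume "\<epsilon> > 0"
  define C where "C = entry_norm N P * entry_norm N Q + 1"
  have C: "C > 0"
    by (simp add: C_def add_nonneg_pos entry_norm_nonneg)
  obtain Y where Y: "Y \<in> S" "Y \<in> carrier_mat N N" "entry_norm N (X - Y) < \<epsilon> / C"
    using mat_closureD(2)[OF X, of "\<epsilon> / C"] \<open>\<epsilon> > 0\<close> C by auto
  have XY: "X - Y \<in> carrier_mat N N" using Y by (intro minus_carrier_mat)
  have "P * X * Q - P * Y * Q = P * (X - Y) * Q"
    using XC Y P Q by (simp add: minus_mult_distrib_mat[of _ N N _ _ N] mult_minus_distrib_mat[of _ N N _ N])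
  also have "entry_norm N \<dots> \<le> entry_norm N (P * (X - Y)) * entry_norm N Q"
    using P Q XY by (intro entry_norm_mult) auto
  also have "\<dots> \<le> entry_norm N P * entry_norm N (X - Y) * entry_norm N Q"
    using P XY by (intro mult_right_mono entry_norm_mult entry_norm_nonneg)
  also have "\<dots> \<le> entry_norm N (X - Y) * C"
    by (simp add: C_def algebra_simps entry_norm_nonneg)
  also have "\<dots> < \<epsilon>"
    using Y C by (simp add: field_simps)
  finally have "entry_norm N (P * X * Q - P * Y * Q) < \<epsilon>" .
  then show "\<exists>Z\<in>(\<lambda>Y. P * Y * Q) ` S. Z \<in> carrier_mat N N \<and> entry_norm N (P * X * Q - Z) < \<epsilon>"
    using Y P Q by (intro bexI[of _ "P * Y * Q"] conjI imageI mult_carrier_mat[of _ N N])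
qed

subsection \<open>Skew polynomials in the cyclic shift\<close>

definition diag_of :: "nat \<Rightarrow> (nat \<Rightarrow> complex) \<Rightarrow> complex mat" where
  "diag_of N f = mat N N (\<lambda>(i, j). if i = j then f i else 0)"

lemma diag_of_carrier [simp]: "diag_of N f \<in> carrier_mat N N"
  by (simp add: diag_of_def)

lemma diag_of_mult_left:
  assumes "X \<in> carrier_mat N N" "i < N" "j < N"
  shows "(diag_of N f * X) $$ (i, j) = f i * X $$ (i, j)"
proof -
  have "(diag_of N f * X) $$ (i, j) = (\<Sum>k<N. (if i = k then f i else 0) * X $$ (k, j))"
    using assms by (auto simp: diag_of_def scalar_prod_def atLeast0LessThan)
  also have "\<dots> = (\<Sum>k<N. if k = i then f i * X $$ (k, j) else 0)"
    by (intro sum.cong) auto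
  finally show ?thesis using assms by simp
qed

lemma diag_of_mult_right:
  assumes "X \<in> carrier_mat N N" "i < N" "j < N"
  shows "(X * diag_of N f) $$ (i, j) = X $$ (i, j) * f j"
proof -
  have "(X * diag_of N f) $$ (i, j) = (\<Sum>k<N. X $$ (i, k) * (if k = j then f k else 0))"
    using assms by (auto simp: diag_of_def scalar_prod_def atLeast0LessThan)
  also have "\<dots> = (\<Sum>k<N. if k = j then X $$ (i, k) * f j else 0)"
    by (intro sum.cong) auto
  finally show ?thesis using assms by simp
qed

text \<open>The evaluation of the skew polynomial with diagonal coefficients \<open>d 0, \<dots>, d m\<close> at the cyclic
  shift.\<close>

definition skew_poly_mat :: "nat \<Rightarrow> nat \<Rightarrow> (nat \<Rightarrow> nat \<Rightarrow> complex) \<Rightarrow> complex mat" where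
  "skew_poly_mat N m d = mat N N (\<lambda>(i, k). \<Sum>j\<le>m. if (i + j) mod N = k then d j i else 0)"

lemma skew_poly_mat_carrier [simp]: "skew_poly_mat N m d \<in> carrier_mat N N"
  by (simp add: skew_poly_mat_def)

abbreviation linear_coeffs :: "(nat \<Rightarrow> complex) \<Rightarrow> (nat \<Rightarrow> complex) \<Rightarrow> nat \<Rightarrow> nat \<Rightarrow> complex" where
  "linear_coeffs a b \<equiv> \<lambda>j. if j = 0 then a else b"

text \<open>The two cases are added because for \<open>N = 1\<close> the shift is the identity and
  both contribute to the same entry.\<close>

lemma linear_skew_poly_mat_entry:
  assumes "i < N" "k < N"
  shows "skew_poly_mat N 1 (linear_coeffs a b) $$ (i, k)
    = (if i = k then a i else 0) + (if Suc i mod N = k then b i else 0)"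
  using assms by (simp add: skew_poly_mat_def)

text \<open>Moving \<open>P^j\<close> to the right past the diagonal matrix of \<open>e\<close>
  turns \<open>e i\<close> into \<open>e (i + j)\<close>; for periodic \<open>e\<close> this matches
  the product of skew polynomials.\<close>

lemma skew_poly_mat_mult_linear:
  assumes e: "\<And>i. e (i + N) = e i"
  shows "skew_poly_mat N m q * skew_poly_mat N 1 (linear_coeffs (\<lambda>i. - e i) (\<lambda>_. 1))
    = skew_poly_mat N (Suc m) (\<lambda>j i. (if j = 0 then 0 else q (j - 1) i)
        - (if j = Suc m then 0 else q j i * e (i + j)))"
    (is "?Q * ?L = ?R")
proof (rule eq_matI)
  fix i k assume "i < dim_row ?R" "k < dim_col ?R"
  then have ik: "i < N" "k < N" by (simp_all add: skew_poly_mat_def)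
  have e_mod: "e (l mod N) = e l" for l
  proof -
    have "e (r + c * N) = e r" for r c
      by (induction c) (use e in \<open>simp_all add: add.assoc[symmetric] add.commute[of N]\<close>)
    from this[of "l mod N" "l div N"] show ?thesis by simp
  qed
  have "(?Q * ?L) $$ (i, k) = (\<Sum>l<N. ?Q $$ (i, l) * ?L $$ (l, k))"
    using ik by (simp add: skew_poly_mat_def scalar_prod_def atLeast0LessThan del: One_nat_def sum.atMost_Suc)
  also have "\<dots> = (\<Sum>l<N. (\<Sum>j\<le>m. if l = (i + j) mod N then q j i * ?L $$ (l, k) else 0))"
    using ik by (intro sum.cong) (auto simp: skew_poly_mat_def[of N m] sum_distrib_right intro!: sum.cong)
  also have "\<dots> = (\<Sum>j\<le>m. q j i * ?L $$ ((i + j) mod N, k))"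
    using ik by (subst sum.swap) (auto intro!: sum.cong)
  also have "\<dots> = (\<Sum>j\<le>m. (if Suc (i + j) mod N = k then q j i else 0)
      - (if (i + j) mod N = k then q j i * e (i + j) else 0))"
  proof (intro sum.cong refl)
    fix j
    have "(i + j) mod N < N" using ik by simp
    then show "q j i * ?L $$ ((i + j) mod N, k) = (if Suc (i + j) mod N = k then q j i else 0)
      - (if (i + j) mod N = k then q j i * e (i + j) else 0)"
      by (subst linear_skew_poly_mat_entry[OF _ ik(2)]) (simp_all only: mod_Suc_eq e_mod, simp add: algebra_simps)
  qed
  also have "\<dots> = (\<Sum>j\<le>Suc m. if (i + j) mod N = k then (if j = 0 then 0 else q (j - 1) i) else 0)
      - (\<Sum>j\<le>Suc m. if (i + j) mod N = k then (if j = Suc m then 0 else q j i * e (i + j)) else 0)"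
  proof -
    have "(\<Sum>j\<le>Suc m. if (i + j) mod N = k then (if j = 0 then 0 else q (j - 1) i) else 0)
      = (\<Sum>j\<le>m. if Suc (i + j) mod N = k then q j i else 0)"
      by (subst sum.atMost_Suc_shift) (auto intro!: sum.cong)
    moreover have "(\<Sum>j\<le>Suc m. if (i + j) mod N = k then (if j = Suc m then 0 else q j i * e (i + j)) else 0)
      = (\<Sum>j\<le>m. if (i + j) mod N = k then q j i * e (i + j) else 0)"
      by (auto intro!: sum.cong)
    ultimately show ?thesis by (simp only: sum_subtractf)
  qed
  also have "\<dots> = ?R $$ (i, k)"
    using ik by (auto simp: skew_poly_mat_def sum_subtractf[symmetric] simp del: sum.atMost_Suc intro!: sum.cong)
  finally show "(?Q * ?L) $$ (i, k) = ?R $$ (i, k)" .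
qed (simp_all add: skew_poly_mat_def)

section \<open>Linear factors and their diagonalization by the Fourier transform\<close>

text \<open>Comparing entries requires \<open>x i * y i = e i\<close> and
  \<open>x i * \<alpha> * y (i + 1) = 1\<close> cyclically, hence
  \<open>y (i + 1) = y i / (\<alpha> * e i)\<close>. Returning to the start after \<open>N\<close>
  steps forces \<open>\<alpha> ^ N\<close> to be the product of all \<open>1 / e j\<close>, which
  has a complex root.\<close>

lemma linear_skew_poly_mat_diagonally_equivalent:
  assumes N: "N > 0" and nz: "\<And>i. e i \<noteq> 0"
  obtains x y \<alpha> where "skew_poly_mat N 1 (linear_coeffs e (\<lambda>_. 1))
    = diag_of N x * skew_poly_mat N 1 (linear_coeffs (\<lambda>_. 1) (\<lambda>_. \<alpha>)) * diag_of N y"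
proof -
  define z where "z = (\<Prod>j<N. 1 / e j)"
  have "z \<noteq> 0" using nz by (simp add: z_def)
  define \<alpha> where "\<alpha> = exp (Ln z / of_nat N)"
  have \<alpha>: "\<alpha> ^ N = z"
    using N \<open>z \<noteq> 0\<close> by (simp add: \<alpha>_def exp_of_nat_mult[symmetric])
  have \<alpha>_nz: "\<alpha> \<noteq> 0" by (simp add: \<alpha>_def)
  define y where "y i = (\<Prod>j<i. 1 / (\<alpha> * e j))" for i
  have y_nz: "y i \<noteq> 0" for i using nz \<alpha>_nz by (simp add: y_def)
  have y_Suc: "y (Suc i mod N) = y i / (\<alpha> * e i)" if "i < N" for i
  proof (cases "Suc i = N")
    case True
    \<comment> \<open>The cyclic closing condition \<open>y N = y 0 = 1\<close>, the only place
      where the value of \<open>\<alpha> ^ N\<close> enters.\<close>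
    have "y N = (\<Prod>j<N. inverse \<alpha> * (1 / e j))"
      by (simp add: y_def field_simps)
    also have "\<dots> = 1"
      unfolding prod.distrib using \<open>z \<noteq> 0\<close> by (simp add: z_def[symmetric] power_inverse \<alpha>)
    finally have "y N = 1" .
    then show ?thesis using True by (auto simp: y_def)
  qed (use that in \<open>simp add: y_def\<close>)
  define x where "x i = e i / y i" for i
  let ?M = "skew_poly_mat N 1 (linear_coeffs (\<lambda>_. 1) (\<lambda>_. \<alpha>))"
  show thesis
  proof (rule that, rule eq_matI)
    fix i k assume "i < dim_row (diag_of N x * ?M * diag_of N y)"
      "k < dim_col (diag_of N x * ?M * diag_of N y)"
    then have ik: "i < N" "k < N" by (simp_all add: diag_of_def)
    have "(diag_of N x * ?M * diag_of N y) $$ (i, k) = x i * ?M $$ (i, k) * y k"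
      using ik by (simp add: diag_of_mult_left diag_of_mult_right mult_carrier_mat[of _ N N] del: One_nat_def)
    also have "\<dots> = (if i = k then e i else 0) + (if Suc i mod N = k then 1 else 0)"
      using y_nz[of i] y_Suc[OF ik(1)] \<alpha>_nz nz[of i] ik
      by (subst linear_skew_poly_mat_entry) (auto simp: x_def field_simps)
    also have "\<dots> = skew_poly_mat N 1 (linear_coeffs e (\<lambda>_. 1)) $$ (i, k)"
      using ik by (subst linear_skew_poly_mat_entry) auto
    finally show "skew_poly_mat N 1 (linear_coeffs e (\<lambda>_. 1)) $$ (i, k)
      = (diag_of N x * ?M * diag_of N y) $$ (i, k)" ..
  qed (simp_all add: diag_of_def skew_poly_mat_def)
qed

text \<open>Row \<open>j\<close> of the Fourier matrix is a left eigenvector of the cyclic shift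
  with eigenvalue \<open>exp (2 * pi * \<i> * j / N)\<close>.\<close>

lemma dft_mat_diagonalizes_circulant:
  assumes N: "N > 0"
  shows "dft_mat N * skew_poly_mat N 1 (linear_coeffs (\<lambda>_. 1) (\<lambda>_. \<alpha>))
    = diag_of N (\<lambda>j. 1 + \<alpha> * exp (2 * of_real pi * \<i> * of_nat j / of_nat N)) * dft_mat N"
    (is "_ * ?M = diag_of N (\<lambda>j. 1 + \<alpha> * ?\<omega> j) * _")
proof (rule eq_matI)
  let ?F = "dft_mat N"
  fix j k assume "j < dim_row (diag_of N (\<lambda>j. 1 + \<alpha> * ?\<omega> j) * ?F)"
    "k < dim_col (diag_of N (\<lambda>j. 1 + \<alpha> * ?\<omega> j) * ?F)"
  then have jk: "j < N" "k < N" by (simp_all add: diag_of_def dft_mat_def)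
  \<comment> \<open>At the wrap-around \<open>i = N - 1\<close> the exponents differ by a multiple
    of \<open>2 * pi * \<i>\<close>.\<close>
  have shift: "?F $$ (j, i) = ?\<omega> j * ?F $$ (j, Suc i mod N)" if "i < N" for i
  proof (cases "Suc i = N")
    case True
    then have "complex_of_nat i = of_nat N - 1" by (metis of_nat_Suc add_diff_cancel_left')
    then have "- (2 * of_real pi * \<i> * of_nat j * of_nat i / of_nat N)
        = 2 * of_real pi * \<i> * of_nat j / of_nat N - (2 * of_int (int j) * pi) * \<i>"
      unfolding \<open>complex_of_nat i = of_nat N - 1\<close> using N by (simp add: field_simps)
    moreover have "exp ((2 * of_int (int j) * pi) * \<i>) = 1"
      by (rule exp_integer_2pi) simp
    ultimately have "?F $$ (j, i) = ?\<omega> j"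
      using that jk by (simp add: dft_mat_def exp_diff)
    then show ?thesis using True jk by (simp add: dft_mat_def)
  next
    case False
    have "- (2 * of_real pi * \<i> * of_nat j * of_nat i / of_nat N) = 2 * of_real pi * \<i> * of_nat j / of_nat N
        + - (2 * of_real pi * \<i> * of_nat j * of_nat (Suc i) / of_nat N)"
      by (simp add: add_divide_distrib algebra_simps)
    then show ?thesis
      using that jk False by (simp add: dft_mat_def exp_add[symmetric] del: of_nat_Suc)
  qed
  have pred: "Suc i mod N = k \<longleftrightarrow> i = (if k = 0 then N - 1 else k - 1)" if "i < N" for i
    using that jk by (auto simp: mod_Suc)
  have "(?F * ?M) $$ (j, k) = (\<Sum>i<N. ?F $$ (j, i) * ?M $$ (i, k))"
    using jk by (simp add: dft_mat_def skew_poly_mat_def scalar_prod_def atLeast0LessThan)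
  also have "\<dots> = (\<Sum>i<N. (if i = k then ?F $$ (j, k) else 0)
      + (if i = (if k = 0 then N - 1 else k - 1) then \<alpha> * ?\<omega> j * ?F $$ (j, k) else 0))"
  proof (intro sum.cong refl)
    fix i assume "i \<in> {..<N}"
    then have i: "i < N" by simp
    show "?F $$ (j, i) * ?M $$ (i, k) = (if i = k then ?F $$ (j, k) else 0)
      + (if i = (if k = 0 then N - 1 else k - 1) then \<alpha> * ?\<omega> j * ?F $$ (j, k) else 0)"
      unfolding linear_skew_poly_mat_entry[OF i jk(2)] pred[OF i, symmetric]
      using shift[OF i] by (auto simp: algebra_simps)
  qed
  also have "\<dots> = (1 + \<alpha> * ?\<omega> j) * ?F $$ (j, k)"
    using jk N less_imp_diff_less[OF jk(2), of 1] by (simp add: sum.distrib algebra_simps)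
  also have "\<dots> = (diag_of N (\<lambda>j. 1 + \<alpha> * ?\<omega> j) * ?F) $$ (j, k)"
    using jk dft_mat_carrier by (simp add: diag_of_mult_left)
  finally show "(?F * ?M) $$ (j, k) = (diag_of N (\<lambda>j. 1 + \<alpha> * ?\<omega> j) * ?F) $$ (j, k)" .
qed (simp_all add: diag_of_def dft_mat_def skew_poly_mat_def)

subsection \<open>Products of diagonal and circulant matrices\<close>

definition afdf_set :: "nat \<Rightarrow> nat \<Rightarrow> complex mat set" where
  "afdf_set N K = {afdf_mat N K A D |A D.
     (\<forall>k \<in> {1..K}. A k \<in> carrier_mat N N \<and> diagonal_mat (A k) \<and>
                    D k \<in> carrier_mat N N \<and> diagonal_mat (D k)) \<and> A 1 = 1\<^sub>m N}"

lemma mat_prod_cong: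
  "(\<And>k. k \<in> {1..K} \<Longrightarrow> M k = M' k) \<Longrightarrow> mat_prod N M K = mat_prod N M' K"
  by (induction K) auto

lemma mat_prod_carrier:
  "(\<And>k. k \<in> {1..K} \<Longrightarrow> M k \<in> carrier_mat N N) \<Longrightarrow> mat_prod N M K \<in> carrier_mat N N"
  by (induction K) (auto intro!: mult_carrier_mat[of _ N N])

lemma diagonal_mat_diag_of [simp]: "diagonal_mat (diag_of N f)"
  by (simp add: diagonal_mat_def diag_of_def)

lemma diag_of_mult_diagonal:
  assumes "D \<in> carrier_mat N N" "diagonal_mat D"
  shows "diagonal_mat (D * diag_of N f)"
  using assms diag_of_mult_right[OF assms(1)] by (simp add: diagonal_mat_def diag_of_def)

text \<open>Conjugation exchanges the two kinds of factors: a diagonal matrix becomes a block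
  \<open>F D F^-1\<close>, and a circulant \<open>1 + \<alpha> P\<close> becomes a diagonal matrix
  that can serve as some \<open>A k\<close>.\<close>

definition dft_conj :: "nat \<Rightarrow> complex mat \<Rightarrow> complex mat" where
  "dft_conj N X = dft_mat N * X * dft_inv N"

lemma dft_conj_carrier: "X \<in> carrier_mat N N \<Longrightarrow> dft_conj N X \<in> carrier_mat N N"
  unfolding dft_conj_def
  by (intro mult_carrier_mat[of _ N N] dft_mat_carrier dft_mat_inverse)

lemma dft_conj_mult:
  assumes X: "X \<in> carrier_mat N N" and Y: "Y \<in> carrier_mat N N"
  shows "dft_conj N (X * Y) = dft_conj N X * dft_conj N Y"
proof -
  let ?F = "dft_mat N" and ?G = "dft_inv N"
  note F = dft_mat_carrier[of N] and G = dft_mat_inverse(2)[of N]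
  have "?F * X * ?G * (?F * Y * ?G) = ?F * X * (?G * ?F * (Y * ?G))"
    using F G X Y by (simp add: assoc_mult_mat[of _ N N _ N _ N])
  also have "\<dots> = ?F * (X * Y) * ?G"
    using F G X Y by (simp add: dft_mat_inverse(4) assoc_mult_mat[of _ N N _ N _ N])
  finally show ?thesis by (simp add: dft_conj_def)
qed

text \<open>The product is extended by one factor. Its index is at least 2, so the constraint on
  \<open>A 1\<close> is preserved.\<close>

lemma afdf_set_step:
  assumes X: "X \<in> afdf_set N (Suc K)" and A: "A \<in> carrier_mat N N" "diagonal_mat A"
  shows "X * (A * dft_conj N (diag_of N y)) \<in> afdf_set N (Suc (Suc K))"
proof -
  note F = dft_mat_carrier[of N] and G = dft_mat_inverse(2)[of N]
  obtain B D where X_eq: "X = afdf_mat N (Suc K) B D"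
    and diag: "\<forall>k \<in> {1..Suc K}. B k \<in> carrier_mat N N \<and> diagonal_mat (B k) \<and>
                    D k \<in> carrier_mat N N \<and> diagonal_mat (D k)" and B1: "B 1 = 1\<^sub>m N"
    using X unfolding afdf_set_def by blast
  define B' where "B' = B(Suc (Suc K) := A)"
  define D' where "D' = D(Suc (Suc K) := diag_of N y)"
  have "X = afdf_mat N (Suc K) B' D'"
    unfolding X_eq afdf_mat_def by (rule mat_prod_cong) (auto simp: B'_def D'_def)
  moreover have "A * dft_conj N (diag_of N y) = A * dft_mat N * diag_of N y * dft_inv N"
    using A F G by (simp add: dft_conj_def assoc_mult_mat[of _ N N _ N _ N])
  ultimately have "X * (A * dft_conj N (diag_of N y)) = afdf_mat N (Suc (Suc K)) B' D'"
    by (simp add: afdf_mat_def B'_def D'_def)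
  moreover have "\<forall>k \<in> {1..Suc (Suc K)}. B' k \<in> carrier_mat N N \<and> diagonal_mat (B' k) \<and>
                    D' k \<in> carrier_mat N N \<and> diagonal_mat (D' k)"
    using diag A by (auto simp: B'_def D'_def)
  moreover have "B' 1 = 1\<^sub>m N"
    using B1 by (simp add: B'_def)
  ultimately show ?thesis unfolding afdf_set_def by blast
qed

text \<open>The last factor already ends in \<open>F D F^-1\<close>, and two such blocks merge into
  one with the product of the diagonal matrices; the order does not grow.\<close>

lemma afdf_set_absorb:
  assumes X: "X \<in> afdf_set N (Suc K)"
  shows "X * dft_conj N (diag_of N x) \<in> afdf_set N (Suc K)"
proof -
  let ?F = "dft_mat N" and ?G = "dft_inv N" and ?x = "diag_of N x"
  note F = dft_mat_carrier[of N] and G = dft_mat_inverse(2)[of N]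
  obtain B D where X_eq: "X = afdf_mat N (Suc K) B D"
    and diag: "\<forall>k \<in> {1..Suc K}. B k \<in> carrier_mat N N \<and> diagonal_mat (B k) \<and>
                    D k \<in> carrier_mat N N \<and> diagonal_mat (D k)" and B1: "B 1 = 1\<^sub>m N"
    using X unfolding afdf_set_def by blast
  define D' where "D' = D(Suc K := D (Suc K) * ?x)"
  define P where "P = mat_prod N (\<lambda>k. B k * ?F * D k * ?G) K"
  have P: "P \<in> carrier_mat N N"
    unfolding P_def using diag
    by (intro mat_prod_carrier mult_carrier_mat[of _ N N] F G) auto
  have BD: "B (Suc K) \<in> carrier_mat N N" "D (Suc K) \<in> carrier_mat N N"
    using diag by auto
  have "P * (B (Suc K) * ?F * D (Suc K) * ?G) * (?F * ?x * ?G)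
      = P * (B (Suc K) * ?F * D (Suc K) * (?G * ?F * (?x * ?G)))"
    using P BD F G by (simp add: assoc_mult_mat[of _ N N _ N _ N] mult_carrier_mat[of _ N N _ N])
  also have "\<dots> = P * (B (Suc K) * ?F * (D (Suc K) * ?x) * ?G)"
    using P BD F G
    by (simp add: dft_mat_inverse(4) assoc_mult_mat[of _ N N _ N _ N] mult_carrier_mat[of _ N N _ N]
        left_mult_one_mat[of _ N N])
  also have "\<dots> = mat_prod N (\<lambda>k. B k * ?F * D' k * ?G) K * (B (Suc K) * ?F * D' (Suc K) * ?G)"
    unfolding P_def by (intro arg_cong2[where f = "(*)"] mat_prod_cong) (auto simp: D'_def)
  finally have "X * dft_conj N ?x = afdf_mat N (Suc K) B D'"
    by (simp add: X_eq afdf_mat_def dft_conj_def P_def)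
  moreover have "\<forall>k \<in> {1..Suc K}. B k \<in> carrier_mat N N \<and> diagonal_mat (B k) \<and>
                    D' k \<in> carrier_mat N N \<and> diagonal_mat (D' k)"
    using diag diag_of_mult_diagonal[OF BD(2)] mult_carrier_mat[OF BD(2) diag_of_carrier]
    by (auto simp: D'_def)
  ultimately show ?thesis using B1 unfolding afdf_set_def by blast
qed

lemma dft_conj_diag_of_in_afdf_set: "dft_conj N (diag_of N x) \<in> afdf_set N 1"
proof -
  have "afdf_mat N 1 (\<lambda>_. 1\<^sub>m N) (\<lambda>_. diag_of N x) = dft_conj N (diag_of N x)"
    using dft_mat_carrier[of N] dft_conj_carrier[of "diag_of N x" N] by (simp add: afdf_mat_def dft_conj_def)
  moreover have "diagonal_mat (1\<^sub>m N :: complex mat)"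
    by (simp add: diagonal_mat_def)
  ultimately show ?thesis
    unfolding afdf_set_def
    by (intro CollectI exI[of _ "\<lambda>_. 1\<^sub>m N"] exI[of _ "\<lambda>_. diag_of N x"]) simp
qed

text \<open>Writing the linear factor as diagonal times circulant times diagonal, conjugation gives
  a block, a diagonal matrix and a block. The first block is absorbed and the other two form one new
  factor, so each degree costs exactly one order.\<close>

lemma afdf_set_mult_linear_factor:
  assumes N: "N > 0" and nz: "\<And>i. e i \<noteq> 0" and X: "X \<in> afdf_set N (Suc K)" "X \<in> carrier_mat N N"
  shows "X * dft_conj N (skew_poly_mat N 1 (linear_coeffs e (\<lambda>_. 1))) \<in> afdf_set N (Suc (Suc K))"
proof -
  note F = dft_mat_carrier[of N] and G = dft_mat_inverse(2)[of N]
  obtain x y \<alpha> where eq: "skew_poly_mat N 1 (linear_coeffs e (\<lambda>_. 1))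
    = diag_of N x * skew_poly_mat N 1 (linear_coeffs (\<lambda>_. 1) (\<lambda>_. \<alpha>)) * diag_of N y"
    (is "_ = _ * ?M * _")
    by (rule linear_skew_poly_mat_diagonally_equivalent[where e = e, OF N nz])
  define z where "z j = 1 + \<alpha> * exp (2 * of_real pi * \<i> * of_nat j / of_nat N)" for j
  have M: "?M \<in> carrier_mat N N" by simp
  have "dft_conj N ?M = diag_of N z * dft_mat N * dft_inv N"
    unfolding dft_conj_def dft_mat_diagonalizes_circulant[OF N] z_def ..
  also have "\<dots> = diag_of N z"
    using F G by (simp add: assoc_mult_mat[of _ N N _ N _ N] dft_mat_inverse(3)
        right_mult_one_mat[of _ N N])
  finally have conj_M: "dft_conj N ?M = diag_of N z" .
  have "X * dft_conj N (skew_poly_mat N 1 (linear_coeffs e (\<lambda>_. 1)))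
      = X * (dft_conj N (diag_of N x) * diag_of N z * dft_conj N (diag_of N y))"
    unfolding eq dft_conj_mult[OF mult_carrier_mat[OF diag_of_carrier M] diag_of_carrier]
      dft_conj_mult[OF diag_of_carrier M] conj_M ..
  also have "\<dots> = X * dft_conj N (diag_of N x) * (diag_of N z * dft_conj N (diag_of N y))"
    using X(2) dft_conj_carrier[of "diag_of N x" N] dft_conj_carrier[of "diag_of N y" N]
    by (simp add: assoc_mult_mat[of _ N N _ N _ N] mult_carrier_mat[of _ N N _ N])
  also have "\<dots> \<in> afdf_set N (Suc (Suc K))"
    by (intro afdf_set_step afdf_set_absorb X) auto
  finally show ?thesis .
qed

subsection \<open>Density\<close>

lemma skew_poly_mat_approx:
  assumes "\<And>j i. j \<le> m \<Longrightarrow> cmod (d j i - d' j i) < \<delta>"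
  shows "entry_norm N (skew_poly_mat N m d - skew_poly_mat N m d') \<le> real N * (real N * (real (Suc m) * \<delta>))"
proof -
  have "cmod ((skew_poly_mat N m d - skew_poly_mat N m d') $$ (i, k)) \<le> real (Suc m) * \<delta>"
    if "i < N" "k < N" for i k
  proof -
    have "(skew_poly_mat N m d - skew_poly_mat N m d') $$ (i, k)
      = (\<Sum>j\<le>m. if (i + j) mod N = k then d j i - d' j i else 0)"
      using that by (auto simp: skew_poly_mat_def sum_subtractf[symmetric] intro!: sum.cong)
    also have "cmod \<dots> \<le> (\<Sum>j\<le>m. \<delta>)"
    proof (rule sum_norm_le)
      fix j assume "j \<in> {..m}"
      then have "cmod (d j i - d' j i) < \<delta>" by (intro assms) simp
      then show "cmod (if (i + j) mod N = k then d j i - d' j i else 0) \<le> \<delta>"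
        using norm_ge_zero[of "d j i - d' j i"] by (auto simp del: norm_ge_zero)
    qed
    finally show ?thesis by simp
  qed
  then have "entry_norm N (skew_poly_mat N m d - skew_poly_mat N m d')
      \<le> (\<Sum>i<N. \<Sum>k<N. real (Suc m) * \<delta>)"
    unfolding entry_norm_def by (intro sum_mono) auto
  then show ?thesis by simp
qed

lemma skew_poly_mat_in_closure_factored:
  assumes N: "N > 0" and per: "\<And>j i. d j (i + N) = d j i"
  shows "skew_poly_mat N (Suc m) d \<in> mat_closure N
    {skew_poly_mat N m q * skew_poly_mat N 1 (linear_coeffs e (\<lambda>_. 1)) | q e.
      (\<forall>j i. q j (i + N) = q j i) \<and> (\<forall>i. e i \<noteq> 0)}" (is "?S \<in> mat_closure N ?T")
proof (rule mat_closureI)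
  fix \<epsilon> :: real assume "\<epsilon> > 0"
  \<comment> \<open>There are \<open>N * N\<close> entries with at most \<open>m + 2\<close>
    coefficients each; the 2 in \<open>\<delta>\<close> makes the final bound strict.\<close>
  define M where "M = real N * (real N * real (Suc (Suc m)))"
  have M: "M > 0" using N by (simp add: M_def)
  define \<delta> where "\<delta> = \<epsilon> / (2 * M)"
  have "\<delta> > 0" using \<open>\<epsilon> > 0\<close> M by (simp add: \<delta>_def)
  obtain q e where q: "\<And>j i. q j (i + N) = q j i" and e: "\<And>i. e (i + N) = e i" "\<And>i. e i \<noteq> 0"
    and close: "\<And>j i. j \<le> Suc m \<Longrightarrow> cmod (d j i -
       ((if j = 0 then 0 else q (j - 1) i) - (if j = Suc m then 0 else q j i * e (i + j)))) < \<delta>"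
    by (rule perturb_to_right_factor[where d = d and m = m, OF N per \<open>\<delta> > 0\<close>]) blast
  let ?Y = "skew_poly_mat N m q * skew_poly_mat N 1 (linear_coeffs (\<lambda>i. - e i) (\<lambda>_. 1))"
  have "entry_norm N (?S - ?Y) \<le> real N * (real N * (real (Suc (Suc m)) * \<delta>))"
    unfolding skew_poly_mat_mult_linear[where e = e, OF e(1)] by (intro skew_poly_mat_approx close)
  also have "\<dots> = \<epsilon> / 2"
  proof -
    have "real N * (real N * (real (Suc (Suc m)) * \<delta>)) = M * \<delta>" by (simp only: M_def mult.assoc)
    then show ?thesis using M by (simp add: \<delta>_def)
  qed
  finally have "entry_norm N (?S - ?Y) < \<epsilon>" using \<open>\<epsilon> > 0\<close> by simp
  moreover have "?Y \<in> ?T"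
    \<comment> \<open>The sign changes because division produces \<open>X - e\<close>, while the set
      is written with constant term \<open>+ e\<close>.\<close>
    by (intro CollectI exI[of _ q] exI[of _ "\<lambda>i. - e i"]) (use q e in auto)
  moreover have "?Y \<in> carrier_mat N N"
    by (intro mult_carrier_mat[of _ N N]) auto
  ultimately show "\<exists>Y\<in>?T. Y \<in> carrier_mat N N \<and> entry_norm N (?S - Y) < \<epsilon>" by blast
qed simp

text \<open>Induction on the degree: up to approximation a linear factor splits off, the quotient is
  handled by the induction hypothesis, and the linear factor adds one order. Degree 0 is a single
  block with \<open>A 1\<close> the identity.\<close>

lemma dft_conj_skew_poly_mat_in_closure:
  assumes N: "N > 0" and per: "\<And>j i. d j (i + N) = d j i"
  shows "dft_conj N (skew_poly_mat N m d) \<in> mat_closure N (afdf_set N (Suc m))"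
  using per
proof (induction m arbitrary: d)
  case 0
  have "skew_poly_mat N 0 d = diag_of N (d 0)"
    by (rule eq_matI) (auto simp: skew_poly_mat_def diag_of_def)
  then show ?case
    using dft_conj_diag_of_in_afdf_set[of N "d 0"]
    by (auto intro!: mat_closure_superset dft_conj_carrier)
next
  case (Suc m)
  let ?T = "{skew_poly_mat N m q * skew_poly_mat N 1 (linear_coeffs e (\<lambda>_. 1)) | q e.
      (\<forall>j i. q j (i + N) = q j i) \<and> (\<forall>i. e i \<noteq> 0)}"
  have "dft_conj N (skew_poly_mat N (Suc m) d) \<in> mat_closure N (dft_conj N ` ?T)"
    using mat_closure_mult[OF skew_poly_mat_in_closure_factored[of N d m, OF N Suc.prems]
        dft_mat_carrier dft_mat_inverse(2)]
    unfolding dft_conj_def by blast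
  moreover have "dft_conj N ` ?T \<subseteq> mat_closure N (afdf_set N (Suc (Suc m)))"
  proof (rule image_subsetI)
    fix Y assume "Y \<in> ?T"
    then obtain q e where Y: "Y = skew_poly_mat N m q * skew_poly_mat N 1 (linear_coeffs e (\<lambda>_. 1))"
      and q: "\<And>j i. q j (i + N) = q j i" and e: "\<And>i. e i \<noteq> 0" by blast
    let ?Q = "dft_conj N (skew_poly_mat N m q)"
    let ?L = "dft_conj N (skew_poly_mat N 1 (linear_coeffs e (\<lambda>_. 1)))"
    have L: "?L \<in> carrier_mat N N" and Q: "?Q \<in> carrier_mat N N" by (intro dft_conj_carrier; simp)+
    let ?I = "1\<^sub>m N :: complex mat"
    \<comment> \<open>The identity on the left only fits the two-sided form. Intersecting with the
      carrier is harmless, since the closure admits only approximants from it.\<close>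
    have "?I * ?Q * ?L \<in> mat_closure N ((\<lambda>X. ?I * X * ?L) ` (afdf_set N (Suc m) \<inter> carrier_mat N N))"
      by (rule mat_closure_mult) (use Suc.IH[of q] q L in \<open>auto simp: mat_closure_def\<close>)
    moreover have "(\<lambda>X. ?I * X * ?L) ` (afdf_set N (Suc m) \<inter> carrier_mat N N)
        \<subseteq> mat_closure N (afdf_set N (Suc (Suc m)))"
      using afdf_set_mult_linear_factor[of N e, OF N e] L
      by (auto intro!: mat_closure_superset mult_carrier_mat[of _ N N])
    ultimately have "?I * ?Q * ?L \<in> mat_closure N (afdf_set N (Suc (Suc m)))"
      by (rule mat_closure_idem)
    moreover have "dft_conj N Y = ?I * ?Q * ?L"
      unfolding Y using Q by (subst dft_conj_mult) auto
    ultimately show "dft_conj N Y \<in> mat_closure N (afdf_set N (Suc (Suc m)))" by simp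
  qed
  ultimately show ?case by (rule mat_closure_idem)
qed

text \<open>Each entry \<open>(i, k)\<close> lies on exactly one of the \<open>N\<close> cyclic
  diagonals, the one with \<open>j\<close> congruent to \<open>k - i\<close>. Thus degree
  \<open>N - 1\<close> suffices, which leads to order \<open>N\<close>.\<close>

lemma mat_eq_skew_poly_mat:
  assumes N: "N > 0" and X: "X \<in> carrier_mat N N"
  shows "X = skew_poly_mat N (N - 1) (\<lambda>j i. X $$ (i mod N, (i + j) mod N))"
proof (rule eq_matI)
  fix i k assume "i < dim_row (skew_poly_mat N (N - 1) (\<lambda>j i. X $$ (i mod N, (i + j) mod N)))"
    "k < dim_col (skew_poly_mat N (N - 1) (\<lambda>j i. X $$ (i mod N, (i + j) mod N)))"
  then have ik: "i < N" "k < N" by (simp_all add: skew_poly_mat_def)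
  define l where "l = (if i \<le> k then k - i else k + N - i)"
  have "(i + j) mod N = k \<longleftrightarrow> j = l" if "j \<le> N - 1" for j
  proof -
    have "(i + j) mod N = (if i + j < N then i + j else i + j - N)"
      using that ik by (auto simp: mod_if)
    then show ?thesis using that ik by (auto simp: l_def)
  qed
  then have "(\<Sum>j\<le>N - 1. if (i + j) mod N = k then X $$ (i mod N, (i + j) mod N) else 0)
      = (\<Sum>j\<le>N - 1. if j = l then X $$ (i, k) else 0)"
    using ik by (intro sum.cong) auto
  also have "\<dots> = X $$ (i, k)"
    using ik by (auto simp: l_def)
  finally show "X $$ (i, k) = skew_poly_mat N (N - 1) (\<lambda>j i. X $$ (i mod N, (i + j) mod N)) $$ (i, k)"
    using ik by (simp add: skew_poly_mat_def)
qed (use X in \<open>simp_all add: skew_poly_mat_def\<close>)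

theorem theorem4:
  fixes N :: nat and \<nu> :: "complex mat \<Rightarrow> real" and W :: "complex mat" and \<epsilon> :: real
  assumes "N \<ge> 1"
    and "is_norm_on_mat N \<nu>"
    and "W \<in> carrier_mat N N"
    and "\<epsilon> > 0"
  shows "\<exists>A D :: nat \<Rightarrow> complex mat.
    (\<forall>k \<in> {1..N}. A k \<in> carrier_mat N N \<and> diagonal_mat (A k) \<and>
                   D k \<in> carrier_mat N N \<and> diagonal_mat (D k)) \<and>
    A 1 = 1\<^sub>m N \<and>
    \<nu> (W - afdf_mat N N A D) < \<epsilon>"
proof -
  note F = dft_mat_carrier[of N] and G = dft_mat_inverse(2)[of N]
  \<comment> \<open>The expansion in powers of the shift is applied to the conjugate of
    \<open>W\<close>, so that \<open>dft_conj\<close> recovers \<open>W\<close> itself.\<close>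
  define X where "X = dft_inv N * W * dft_mat N"
  have X: "X \<in> carrier_mat N N"
    unfolding X_def using F G assms(3) by (intro mult_carrier_mat[of _ N N])
  have "dft_conj N X = (dft_mat N * dft_inv N) * W * (dft_mat N * dft_inv N)"
    unfolding X_def dft_conj_def using F G assms(3) by (simp add: assoc_mult_mat[of _ N N _ N _ N])
  then have W: "W = dft_conj N X"
    using assms(3) by (simp add: dft_mat_inverse(3))
  define d where "d j i = X $$ (i mod N, (i + j) mod N)" for j i
  have "d j (i + N) = d j i" for j i
  proof -
    have "i + N + j = i + j + N" by simp
    then show ?thesis by (simp only: d_def mod_add_self2)
  qed
  then have "W \<in> mat_closure N (afdf_set N N)"
    using dft_conj_skew_poly_mat_in_closure[of N d "N - 1"] mat_eq_skew_poly_mat[OF _ X] assms(1) W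
    by (simp add: d_def[abs_def])
  moreover obtain C where C: "C > 0" "\<And>X. X \<in> carrier_mat N N \<Longrightarrow> \<nu> X \<le> C * entry_norm N X"
    using norm_on_mat_le_entry_norm[OF assms(2)] by blast
  ultimately obtain Y where Y: "Y \<in> afdf_set N N" "Y \<in> carrier_mat N N" "entry_norm N (W - Y) < \<epsilon> / C"
    using mat_closureD(2)[of W N "afdf_set N N" "\<epsilon> / C"] assms(4) by auto
  have "\<nu> (W - Y) \<le> C * entry_norm N (W - Y)"
    using Y(2) by (intro C minus_carrier_mat)
  also have "\<dots> < \<epsilon>"
    using Y(3) C(1) by (simp add: field_simps)
  finally show ?thesis
    using Y(1) unfolding afdf_set_def by blast
qed

end
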